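(* Let $\mathtt{a},\mathtt{b}$ be two letters identified with fixed positive real numbers, let $s>0$, and let $M_s(w)=\prod_{k=1}^{|w|}(s+w_k)^{-1}$ for a finite word $w=w_1\cdots w_{|w|}$ over $\{\mathtt{a},\mathtt{b}\}$. For $\varepsilon\in(0,1]$ let $$w_\varepsilon=\begin{cases}(\mathtt{a}\mathtt{b})^{\lfloor\varepsilon^{-1}\rfloor}&\text{if }\lfloor\log_2(1/\varepsilon)\rfloor\text{ is even},\\(\mathtt{b}\mathtt{a})^{\lfloor\varepsilon^{-1}\rfloor}&\text{if }\lfloor\log_2(1/\varepsilon)\rfloor\text{ is odd},\end{cases}$$ and $z_\varepsilon:=M_s\bigl(w_\varepsilon[1\ldots N_0(\varepsilon)]\bigr)$ with $N_0(\varepsilon)=\lfloor\log_2(1/\varepsilon)\rfloor$. Then the limit $\Phi_{\mathrm{LC}}(z)$ exists and $$\Phi_{\mathrm{LC}}(z)=-\tfrac12\log\bigl((s+\mathtt{a})(s+\mathtt{b})\bigr).$$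
   Context: $w[1\ldots n]$ denotes the prefix of length $n$ of the word $w$ (and $w[1\ldots n]:=w$ if $n>|w|$, where $|w|$ is the length of $w$). $\log$ is the natural logarithm. For a net $(z_\varepsilon)_{\varepsilon\in(0,1]}$ of non-zero complex numbers, the logarithmic Cesàro mean is $$\Phi_{\mathrm{LC}}(z):=\lim_{T\to\infty}\frac1T\int_1^T\frac{\log|z_{2^{-t}}|}{t}\,dt,$$ whenever the limit exists. *)

theory Defs
  imports "HOL-Analysis.Analysis"
begin

text \<open>A net indexed by \<open>(0,1]\<close> is a function on the reals, of which only the values on
  \<open>{0<..1}\<close> matter.\<close>

definition LC_average :: "(real \<Rightarrow> complex) \<Rightarrow> real \<Rightarrow> real" where
  "LC_average z T = (1 / T) * (LINT t:{1..T}|lebesgue. ln (norm (z (2 powr (- t)))) / t)"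

text \<open>Since \<open>ln 0 = 0\<close> and the integral of a non-integrable function is \<open>0\<close> by convention,
  non-vanishing of the net and integrability are required explicitly.\<close>

definition has_LC_mean :: "(real \<Rightarrow> complex) \<Rightarrow> real \<Rightarrow> bool" where
  "has_LC_mean z L \<longleftrightarrow>
     (\<forall>\<epsilon>\<in>{0<..1}. z \<epsilon> \<noteq> 0) \<and>
     (\<forall>T\<ge>1. set_integrable lebesgue {1..T} (\<lambda>t. ln (norm (z (2 powr (- t)))) / t)) \<and>
     (LC_average z \<longlongrightarrow> L) at_top"

definition Phi_LC :: "(real \<Rightarrow> complex) \<Rightarrow> real" where
  "Phi_LC z = Lim at_top (LC_average z)"

text \<open>Letters are identified with real numbers, so words are lists of reals. The prefix of length
  \<open>n\<close> of \<open>w\<close> is \<open>take n w\<close>, which is \<open>w\<close> itself if \<open>n\<close> exceeds the length.\<close>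

definition M :: "real \<Rightarrow> real list \<Rightarrow> real" where
  "M s w = (\<Prod>k<length w. inverse (s + w ! k))"

definition word_power :: "'a list \<Rightarrow> nat \<Rightarrow> 'a list" where
  "word_power u n = concat (replicate n u)"

definition N0 :: "real \<Rightarrow> nat" where
  "N0 \<epsilon> = nat \<lfloor>log 2 (1 / \<epsilon>)\<rfloor>"

definition w_net :: "real \<Rightarrow> real \<Rightarrow> real \<Rightarrow> real list" where
  "w_net a b \<epsilon> =
     (if even \<lfloor>log 2 (1 / \<epsilon>)\<rfloor> then word_power [a, b] (nat \<lfloor>1 / \<epsilon>\<rfloor>)
      else word_power [b, a] (nat \<lfloor>1 / \<epsilon>\<rfloor>))"

definition z_net :: "real \<Rightarrow> real \<Rightarrow> real \<Rightarrow> real \<Rightarrow> complex" where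
  "z_net s a b \<epsilon> = complex_of_real (M s (take (N0 \<epsilon>) (w_net a b \<epsilon>)))"

end

theory Submission imports Defs begin

text \<open>
  Put \<open>\<epsilon> = 2 powr (- t)\<close> with \<open>t \<ge> 0\<close>. Then \<open>N0 \<epsilon> = \<lfloor>t\<rfloor>\<close>, and \<open>w_net a b \<epsilon>\<close> is a long enough
  alternating word for its prefix of length \<open>\<lfloor>t\<rfloor>\<close> to have exactly \<open>\<lfloor>t\<rfloor>\<close> letters. In an alternating
  word both letters occur equally often, up to one surplus letter when the length is odd, so
  \<open>ln \<bar>z\<bar>\<close> differs from \<open>c * \<lfloor>t\<rfloor>\<close>, where \<open>c = - ln ((s + a) * (s + b)) / 2\<close>, by a bounded amount
  (lemma \<open>ln_norm_z_net\<close>). The choice between \<open>ab\<close> and \<open>ba\<close> only decides which letter is the surplus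
  one, so it is absorbed by the bounded error. Dividing by \<open>t\<close> gives a function that tends to \<open>c\<close>,
  and the Cesaro mean of a function with a limit is that limit (lemma \<open>tendsto_average\<close>).
\<close>

section \<open>Continuous averages of functions with a limit\<close>

text \<open>Beyond a point \<open>S\<close> after which \<open>f\<close> is within \<open>\<epsilon>\<close> of its limit, the integral of the deviation
  grows at rate at most \<open>\<epsilon>\<close>; what happens before \<open>S\<close>, and the mismatch between \<open>T - 1\<close> and \<open>T\<close>, are
  constants that the division by \<open>T\<close> removes.\<close>

lemma tendsto_average:
  fixes f :: "real \<Rightarrow> real"
  assumes int: "\<And>T. T \<ge> 1 \<Longrightarrow> set_integrable lebesgue {1..T} f"
    and lim: "(f \<longlongrightarrow> c) at_top"
  shows "((\<lambda>T. (1 / T) * (LINT t:{1..T}|lebesgue. f t)) \<longlongrightarrow> c) at_top"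
proof (rule tendstoI)
  fix e :: real assume e: "e > 0"
  have "eventually (\<lambda>t. dist (f t) c < e / 2) at_top"
    using tendstoD[OF lim, of "e / 2"] e by simp
  then obtain S0 where S0: "\<And>t. t \<ge> S0 \<Longrightarrow> \<bar>f t - c\<bar> < e / 2"
    by (auto simp: eventually_at_top_linorder dist_real_def)
  define S where "S = max 1 S0"
  have S: "S \<ge> 1" and near: "\<And>t. t \<ge> S \<Longrightarrow> \<bar>f t - c\<bar> \<le> e / 2"
    using S0 by (auto simp: S_def less_imp_le)
  define K where "K = \<bar>(LINT t:{1..S}|lebesgue. f t) - c * S\<bar>"
  have bound: "\<bar>(LINT t:{1..T}|lebesgue. f t) - c * T\<bar> \<le> K + e / 2 * (T - S)" if T: "T \<ge> S" for T
  proof -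
    have intST: "set_integrable lebesgue {S<..T} f"
      by (rule set_integrable_subset[OF int[of T]]) (use S T in auto)
    have const: "set_integrable lebesgue {S<..T} (\<lambda>t. x)" for x :: real
      unfolding set_integrable_def using T
      by (intro integrable_scaleR_left integrable_real_indicator) auto
    have "{1..T} = {1..S} \<union> {S<..T}" using S T by auto
    then have split: "(LINT t:{1..T}|lebesgue. f t)
        = (LINT t:{1..S}|lebesgue. f t) + (LINT t:{S<..T}|lebesgue. f t)"
      using set_integral_Un[OF _ int[OF S] intST] by (simp add: ivl_disj_int)
    have val: "(LINT t:{S<..T}|lebesgue. x) = x * (T - S)" for x :: real
      using T by (simp add: set_lebesgue_integral_def)
    have sandwich: "c - e / 2 \<le> f t" "f t \<le> c + e / 2" if "S < t" for t
      using near[of t] that by linarith+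
    have "(LINT t:{S<..T}|lebesgue. f t) \<le> (LINT t:{S<..T}|lebesgue. c + e / 2)"
      by (rule set_integral_mono[OF intST const]) (simp add: sandwich)
    moreover have "(LINT t:{S<..T}|lebesgue. c - e / 2) \<le> (LINT t:{S<..T}|lebesgue. f t)"
      by (rule set_integral_mono[OF const intST]) (simp add: sandwich)
    ultimately have "\<bar>(LINT t:{S<..T}|lebesgue. f t) - c * (T - S)\<bar> \<le> e / 2 * (T - S)"
      unfolding val abs_le_iff distrib_right left_diff_distrib by linarith
    then show ?thesis unfolding split K_def right_diff_distrib by linarith
  qed
  have "((\<lambda>T. K / T) \<longlongrightarrow> 0) at_top"
    by (intro tendsto_divide_0[OF tendsto_const] filterlim_at_top_imp_at_infinity filterlim_ident)
  then have "eventually (\<lambda>T. K / T < e / 2) at_top"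
    using e by (intro order_tendstoD(2)) auto
  then show "eventually (\<lambda>T. dist ((1 / T) * (LINT t:{1..T}|lebesgue. f t)) c < e) at_top"
    using eventually_ge_at_top[of S]
  proof eventually_elim
    case (elim T)
    have T: "T > 0" using elim S by linarith
    have "e / 2 * (T - S) \<le> e / 2 * T" using e S by (intro mult_left_mono) auto
    then have "\<bar>(LINT t:{1..T}|lebesgue. f t) - c * T\<bar> < e * T"
      using bound[of T] elim T by (simp add: field_simps)
    moreover have "(1 / T) * (LINT t:{1..T}|lebesgue. f t) - c
        = ((LINT t:{1..T}|lebesgue. f t) - c * T) / T"
      using T by (simp add: field_simps)
    ultimately show ?case
      using T by (simp only: dist_real_def abs_divide) (simp add: divide_less_eq)
  qed
qed

section \<open>Prefixes of alternating words\<close>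

lemma length_word_power: "length (word_power u n) = n * length u"
  by (induction n) (auto simp: word_power_def)

lemma set_word_power_subset: "set (word_power u n) \<subseteq> set u"
  by (auto simp: word_power_def)

lemma nth_word_power_pair:
  "k < 2 * m \<Longrightarrow> word_power [x, y] m ! k = (if even k then x else y)"
proof (induction m arbitrary: k)
  case (Suc m)
  have step: "word_power [x, y] (Suc m) = x # y # word_power [x, y] m"
    by (simp add: word_power_def)
  consider "k = 0" | "k = 1" | j where "k = Suc (Suc j)" by (metis One_nat_def nat.exhaust)
  then show ?case using Suc by cases (auto simp: step)
qed simp

lemma M_pos:
  assumes "\<And>x. x \<in> set w \<Longrightarrow> s + x > 0"
  shows "M s w > 0"
  using assms by (auto simp: M_def intro!: prod_pos)

lemma ln_M:
  assumes "\<And>x. x \<in> set w \<Longrightarrow> s + x > 0"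
  shows "ln (M s w) = - (\<Sum>k<length w. ln (s + w ! k))"
proof -
  have pos: "s + w ! k > 0" if "k < length w" for k using assms that by simp
  then have "ln (M s w) = (\<Sum>k<length w. ln (inverse (s + w ! k)))"
    unfolding M_def by (subst ln_prod) (force dest: pos)+
  also have "\<dots> = (\<Sum>k<length w. - ln (s + w ! k))"
    by (rule sum.cong) (auto simp: ln_inverse pos)
  finally show ?thesis by (simp add: sum_negf)
qed

lemma sum_alternating:
  fixes x y :: real and n :: nat
  shows "(\<Sum>k<n. if even k then x else y) = n * ((x + y) / 2) + (if odd n then (x - y) / 2 else 0)"
  by (induction n) (auto simp: field_simps)

lemma ln_M_take_word_power:
  assumes "s + x > 0" and "s + y > 0" and n: "n \<le> 2 * m"
  shows "ln (M s (take n (word_power [x, y] m)))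
    = - (n * ((ln (s + x) + ln (s + y)) / 2)) - (if odd n then (ln (s + x) - ln (s + y)) / 2 else 0)"
proof -
  let ?w = "take n (word_power [x, y] m)"
  have len: "length ?w = n" using n by (simp add: length_word_power)
  have "ln (M s ?w) = - (\<Sum>k<length ?w. ln (s + ?w ! k))"
    using assms set_word_power_subset[of "[x, y]" m] by (intro ln_M) (auto dest!: in_set_takeD)
  also have "(\<Sum>k<length ?w. ln (s + ?w ! k)) = (\<Sum>k<n. if even k then ln (s + x) else ln (s + y))"
    unfolding len using n by (intro sum.cong) (auto simp: nth_word_power_pair)
  finally show ?thesis unfolding sum_alternating by simp
qed

section \<open>The net at a dyadic scale\<close>

lemma M_take_w_net_pos:
  assumes "s + a > 0" and "s + b > 0"
  shows "M s (take n (w_net a b \<epsilon>)) > 0"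
  using assms set_word_power_subset[of "[a, b]"] set_word_power_subset[of "[b, a]"]
  by (intro M_pos) (fastforce simp: w_net_def dest!: in_set_takeD split: if_splits)

lemma z_net_nonzero:
  assumes "s + a > 0" and "s + b > 0"
  shows "z_net s a b \<epsilon> \<noteq> 0"
  using M_take_w_net_pos[OF assms, of "N0 \<epsilon>" \<epsilon>] by (simp add: z_net_def)

text \<open>The prefix that starts with \<open>b\<close> is the one of odd length, so a surplus letter is always \<open>b\<close>.\<close>

lemma ln_norm_z_net:
  assumes a: "s + a > 0" and b: "s + b > 0" and t: "t \<ge> 0"
  shows "ln (norm (z_net s a b (2 powr (- t))))
    = of_int \<lfloor>t\<rfloor> * (- (1 / 2) * ln ((s + a) * (s + b)))
      - (if odd \<lfloor>t\<rfloor> then (ln (s + b) - ln (s + a)) / 2 else 0)"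
proof -
  define n where "n = nat \<lfloor>t\<rfloor>"
  define m where "m = nat \<lfloor>2 powr t\<rfloor>"
  have inv: "1 / 2 powr (- t) = 2 powr t" by (simp add: powr_minus_divide)
  have fl: "\<lfloor>t\<rfloor> = int n" using t by (simp add: n_def)
  have "real n \<le> t" using fl by linarith
  then have "2 ^ n \<le> 2 powr t" by (simp flip: powr_realpow)
  then have "real n \<le> 2 powr t"
    using of_nat_less_two_power[of n, where 'a = real] by linarith
  \<comment> \<open>The word of length \<open>2 * m\<close> is long enough for the prefix not to be cut short.\<close>
  then have nm: "n \<le> 2 * m" unfolding m_def by linarith
  have N0: "N0 (2 powr (- t)) = n" by (simp add: N0_def inv n_def)
  have w: "w_net a b (2 powr (- t)) = (if even n then word_power [a, b] m else word_power [b, a] m)"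
    by (simp add: w_net_def inv fl m_def)
  let ?w = "take n (w_net a b (2 powr (- t)))"
  have "ln (norm (z_net s a b (2 powr (- t)))) = ln (M s ?w)"
    using M_take_w_net_pos[OF a b, of n "2 powr (- t)"] by (simp add: z_net_def N0)
  then show ?thesis
    using ln_M_take_word_power[OF a b nm] ln_M_take_word_power[OF b a nm]
    by (simp add: w fl ln_mult_pos[OF a b] add.commute[of "ln (s + b)"])
qed

theorem theorem4p2:
  fixes a b s :: real
  assumes "a > 0" and "b > 0" and "s > 0"
  shows "(\<exists>L. has_LC_mean (z_net s a b) L) \<and>
         Phi_LC (z_net s a b) = - (1 / 2) * ln ((s + a) * (s + b))"
proof -
  have a: "s + a > 0" and b: "s + b > 0" using assms by auto
  define c where "c = - (1 / 2) * ln ((s + a) * (s + b))"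
  define d where "d = (ln (s + b) - ln (s + a)) / 2"
  define f where "f t = ln (norm (z_net s a b (2 powr (- t)))) / t" for t
  \<comment> \<open>The closed form of \<open>f\<close>, valid for \<open>t \<ge> 0\<close>; measurability is read off from it.\<close>
  define g where "g t = (of_int \<lfloor>t\<rfloor> * c - (if odd \<lfloor>t\<rfloor> then d else 0)) / t" for t :: real
  have fg: "f t = g t" if "t \<ge> 0" for t
    unfolding f_def g_def c_def d_def by (subst ln_norm_z_net[OF a b that]) simp
  have g_near: "\<bar>g t - c\<bar> \<le> (\<bar>c\<bar> + \<bar>d\<bar>) / t" if "t > 0" for t
  proof -
    have "\<bar>(of_int \<lfloor>t\<rfloor> - t) * c\<bar> \<le> 1 * \<bar>c\<bar>"
      unfolding abs_mult by (intro mult_right_mono) linarith+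
    then have "\<bar>(of_int \<lfloor>t\<rfloor> - t) * c - (if odd \<lfloor>t\<rfloor> then d else 0)\<bar> \<le> \<bar>c\<bar> + \<bar>d\<bar>"
      by auto
    moreover have "g t - c = ((of_int \<lfloor>t\<rfloor> - t) * c - (if odd \<lfloor>t\<rfloor> then d else 0)) / t"
      using that by (simp add: g_def field_simps)
    ultimately show ?thesis using that by (simp add: divide_right_mono)
  qed
  have lim: "(f \<longlongrightarrow> c) at_top"
  proof -
    have "((\<lambda>t. (\<bar>c\<bar> + \<bar>d\<bar>) / t) \<longlongrightarrow> 0) at_top"
      by (intro tendsto_divide_0[OF tendsto_const] filterlim_at_top_imp_at_infinity filterlim_ident)
    then have "((\<lambda>t. f t - c) \<longlongrightarrow> 0) at_top"
      by (rule Lim_null_comparison[rotated])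
         (use eventually_gt_at_top[of 0] in eventually_elim, use g_near fg in auto)
    then show ?thesis by (simp add: LIM_zero_iff)
  qed
  have int: "set_integrable lebesgue {1..T} f" for T
  proof -
    have meas: "g \<in> borel_measurable lborel"
    proof -
      have "(\<lambda>t::real. real_of_int \<lfloor>t\<rfloor>) \<in> borel_measurable borel"
        and "(\<lambda>t::real. (\<lambda>k. if odd k then d else 0) \<lfloor>t\<rfloor>) \<in> borel_measurable borel"
        by measurable
      then show ?thesis unfolding g_def by simp
    qed
    have bnd: "norm (g t) \<le> 2 * \<bar>c\<bar> + \<bar>d\<bar>" if "t \<in> {1..T}" for t
    proof -
      have "(\<bar>c\<bar> + \<bar>d\<bar>) / t \<le> \<bar>c\<bar> + \<bar>d\<bar>"
        using that divide_left_mono[of 1 t "\<bar>c\<bar> + \<bar>d\<bar>"] by simp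
      moreover have "\<bar>g t\<bar> \<le> \<bar>g t - c\<bar> + \<bar>c\<bar>" by linarith
      ultimately show ?thesis using g_near[of t] that by simp
    qed
    have "set_integrable lborel {1..T} g"
      unfolding set_integrable_def
      by (rule integrableI_bounded_set_indicator[where B = "2 * \<bar>c\<bar> + \<bar>d\<bar>"])
         (use meas bnd in \<open>auto simp: emeasure_lborel_Icc_eq\<close>)
    then have "set_integrable lebesgue {1..T} g"
      by (simp add: set_integrable_def integrable_completion)
    then show ?thesis
      by (rule set_integrable_cong[THEN iffD1, rotated -1]) (auto simp: fg)
  qed
  have avg: "(LC_average (z_net s a b) \<longlongrightarrow> c) at_top"
    using tendsto_average[OF int lim] by (simp add: LC_average_def[abs_def] f_def)
  have "has_LC_mean (z_net s a b) c"
    unfolding has_LC_mean_def using z_net_nonzero[OF a b] int avg by (auto simp: f_def[abs_def])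
  moreover have "Phi_LC (z_net s a b) = c"
    unfolding Phi_LC_def by (rule tendsto_Lim[OF _ avg]) simp
  ultimately show ?thesis unfolding c_def by blast
qed

end
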